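(* The algorithm REF-ROU, applied to the REF-LU factorization of an $n\times n$ matrix $A$ and update vectors $\mathbf{v},\mathbf{w}\in\mathbb{Z}^n$, requires $O(n^2)$ operations.
   Context: An operation is one addition, subtraction, multiplication or division of two vector/matrix entries. $A\in\mathbb{Z}^{n\times n}$ and $\hat A=A+\mathbf{v}\mathbf{w}^T$ are assumed to have all leading principal minors nonzero, $n\ge2$; the input is the pair of triangular integer matrices $L$ (lower) and $U$ (upper) of the REF-LU factorization of $A$, the vectors $\mathbf{v},\mathbf{w}$, and the diagonal of $A$, such that all divisions below are defined. REF-LU factorization of $M$ with nonzero leading principal minors: define $m^{(0)}_{i,j}=m_{i,j}$, $\rho^{(0)}=1$, and for $k=1,\dots,n$, $\rho^{(k)}=m^{(k-1)}_{k,k}$ and, for $k\le i,j\le n$, $m^{(k)}_{i,j}=m^{(k-1)}_{i,j}$ if $i=k$, $m^{(k)}_{i,j}=\bigl(\rho^{(k)}m^{(k-1)}_{i,j}-m^{(k-1)}_{k,j}m^{(k-1)}_{i,k}\bigr)/\rho^{(k-1)}$ otherwise; then $l_{i,j}=m^{(j-1)}_{i,j}$ for $i\ge j$, $u_{i,j}=m^{(i-1)}_{i,j}$ for $i\le j$, $D=\operatorname{diag}(\rho^{(i-1)}\rho^{(i)})$, and $M=LD^{-1}U$. Forward substitution step, for lower-triangular $\Lambda=(\lambda_{i,j})$, with $\lambda_{0,0}=1$: $\mathbf{y}^{(k)}=\text{Step}(\mathbf{y}^{(k-1)},\Lambda,k)$ has $y^{(k)}_i=y^{(k-1)}_i$ for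 $i\le k$ and $y^{(k)}_i=\bigl(\lambda_{k,k}y^{(k-1)}_i-\lambda_{i,k}y^{(k-1)}_k\bigr)/\lambda_{k-1,k-1}$ for $i>k$. Algorithm REF-ROU (with $\hat l_{0,0}=\hat u_{0,0}=1$; diagonals of $\hat l$ and $\hat u$ always receive the same value, computed once): 1. $\hat l_{1,1}=\hat u_{1,1}:=a_{1,1}+v_1w_1$. For $i=2,\dots,n$: $\hat u_{1,i}:=u_{1,i}+v_1w_i$; $\hat l_{i,1}:=l_{i,1}+v_iw_1$; $\hat l_{i,i}=\hat u_{i,i}:=a_{i,i}+v_iw_i$. 2. $\mathbf{y}^{(0)}:=\mathbf{v}$, $\mathbf{z}^{(0)}:=\mathbf{w}$, $\mathbf{y}^{(1)}:=\text{Step}(\mathbf{y}^{(0)},L,1)$, $\mathbf{z}^{(1)}:=\text{Step}(\mathbf{z}^{(0)},U^T,1)$. 3. For $k=2,\dots,n-1$: $\mathbf{y}^{(k)}:=\text{Step}(\mathbf{y}^{(k-1)},L,k)$, $\mathbf{z}^{(k)}:=\text{Step}(\mathbf{z}^{(k-1)},U^T,k)$; then for $i=k,\dots,n$: (a) $\hat l_{i,i}=\hat u_{i,i}\leftarrow\bigl(\hat l_{k-1,k-1}\hat l_{i,i}-\hat u_{k-1,i}\hat l_{i,k-1}\bigr)/\hat l_{k-2,k-2}$; (b) if $i>k$, $\hat l_{i,k}:=\bigl(\hat l_{k,k}y^{(k-1)}_i-\hat l_{k-1,k-1}y^{(k)}_i\bigr)/y^{(k-1)}_k$ and $\hat u_{k,i}:=\bigl(\hat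 u_{k,k}z^{(k-1)}_i-\hat u_{k-1,k-1}z^{(k)}_i\bigr)/z^{(k-1)}_k$. 4. $\hat l_{n,n}=\hat u_{n,n}\leftarrow\bigl(\hat l_{n-1,n-1}\hat l_{n,n}-\hat u_{n-1,n}\hat l_{n,n-1}\bigr)/\hat l_{n-2,n-2}$. Return $\hat l,\hat u$. *)

theory Defs
  imports
    Jordan_Normal_Form.Determinant
    "HOL-Library.Landau_Symbols"
    "HOL-Library.Monad_Syntax"
begin

text \<open>
  All indices in the factorization and in the algorithm are 1-based, as is usual on paper, whereas
  \<^const>\<open>index_mat\<close> and \<^const>\<open>vec_index\<close> are 0-based; the two functions below translate.
  Arithmetic takes place in \<^typ>\<open>rat\<close>, so that the divisions are exact and no integrality result
  is built into the definitions.
\<close>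

definition mat_at :: "int mat \<Rightarrow> nat \<Rightarrow> nat \<Rightarrow> rat" where
  "mat_at M i j = rat_of_int (M $$ (i - 1, j - 1))"

definition vec_at :: "int vec \<Rightarrow> nat \<Rightarrow> rat" where
  "vec_at x i = rat_of_int (x $ (i - 1))"

definition leading_minor :: "int mat \<Rightarrow> nat \<Rightarrow> int" where
  "leading_minor M k = det (mat k k (\<lambda>ij. M $$ ij))"

definition leading_minors_nonzero :: "int mat \<Rightarrow> bool" where
  "leading_minors_nonzero M \<longleftrightarrow> (\<forall>k\<in>{1..dim_row M}. leading_minor M k \<noteq> 0)"

definition rank_one_update :: "int mat \<Rightarrow> int vec \<Rightarrow> int vec \<Rightarrow> int mat" where
  "rank_one_update A v w = A + mat_of_cols (dim_vec v) [v] * mat_of_rows (dim_vec w) [w]"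


section \<open>REF-LU factorization\<close>

text \<open>
  \<open>elim M k i j\<close> is the entry $m^{(k)}_{i,j}$; it is meaningful for $k \le i, j \le n$ only (with
  $1 \le i, j$), and only such entries are ever used.  \<open>pivot M k\<close> is $\rho^{(k)}$.
\<close>

fun elim :: "int mat \<Rightarrow> nat \<Rightarrow> nat \<Rightarrow> nat \<Rightarrow> rat"
  and pivot :: "int mat \<Rightarrow> nat \<Rightarrow> rat" where
  "pivot M 0 = 1"
| "pivot M (Suc k) = elim M k (Suc k) (Suc k)"
| "elim M 0 i j = mat_at M i j"
| "elim M (Suc k) i j =
     (if i = Suc k then elim M k i j
      else (pivot M (Suc k) * elim M k i j - elim M k (Suc k) j * elim M k i (Suc k)) / pivot M k)"

definition ref_L :: "int mat \<Rightarrow> nat \<Rightarrow> nat \<Rightarrow> rat" where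
  "ref_L M i j = (if j \<le> i then elim M (j - 1) i j else 0)"

definition ref_U :: "int mat \<Rightarrow> nat \<Rightarrow> nat \<Rightarrow> rat" where
  "ref_U M i j = (if i \<le> j then elim M (i - 1) i j else 0)"


section \<open>Computations with an operation count\<close>

text \<open>
  \<open>Done x c\<close> is a run that returns \<open>x\<close> after \<open>c\<close> arithmetic operations on entries; \<open>Undefined\<close> is a
  run that attempts a division by zero.  Only the four operations below are charged for; index
  arithmetic, copying and storing are free.
\<close>

datatype 'a comp = Undefined | Done 'a nat

fun bind_comp :: "'a comp \<Rightarrow> ('a \<Rightarrow> 'b comp) \<Rightarrow> 'b comp" where
  "bind_comp Undefined f = Undefined"
| "bind_comp (Done x c) f =
     (case f x of Undefined \<Rightarrow> Undefined | Done y d \<Rightarrow> Done y (c + d))"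

adhoc_overloading Monad_Syntax.bind \<rightleftharpoons> bind_comp

definition ret :: "'a \<Rightarrow> 'a comp" where
  "ret x = Done x 0"

definition add :: "rat \<Rightarrow> rat \<Rightarrow> rat comp" where
  "add x y = Done (x + y) 1"

definition sub :: "rat \<Rightarrow> rat \<Rightarrow> rat comp" where
  "sub x y = Done (x - y) 1"

definition mul :: "rat \<Rightarrow> rat \<Rightarrow> rat comp" where
  "mul x y = Done (x * y) 1"

definition quot :: "rat \<Rightarrow> rat \<Rightarrow> rat comp" where
  "quot x y = (if y = 0 then Undefined else Done (x / y) 1)"

text \<open>\<open>for_loop m n f s\<close> runs \<open>f m\<close>, \<open>f (m + 1)\<close>, \dots, \<open>f n\<close> in this order on the state \<open>s\<close>.\<close>

primrec for_list :: "nat list \<Rightarrow> (nat \<Rightarrow> 's \<Rightarrow> 's comp) \<Rightarrow> 's \<Rightarrow> 's comp" where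
  "for_list [] f s = ret s"
| "for_list (i # is) f s = do { s' \<leftarrow> f i s; for_list is f s' }"

definition for_loop :: "nat \<Rightarrow> nat \<Rightarrow> (nat \<Rightarrow> 's \<Rightarrow> 's comp) \<Rightarrow> 's \<Rightarrow> 's comp" where
  "for_loop m n f s = for_list [m..<Suc n] f s"


section \<open>The algorithm REF-ROU\<close>

text \<open>\<open>add_mul a x y\<close> computes $a + xy$; \<open>cross a b c d e\<close> computes $(ab - cd)/e$.\<close>

definition add_mul :: "rat \<Rightarrow> rat \<Rightarrow> rat \<Rightarrow> rat comp" where
  "add_mul a x y = do { p \<leftarrow> mul x y; add a p }"

definition cross :: "rat \<Rightarrow> rat \<Rightarrow> rat \<Rightarrow> rat \<Rightarrow> rat \<Rightarrow> rat comp" where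
  "cross a b c d e =
     do { p \<leftarrow> mul a b; q \<leftarrow> mul c d; r \<leftarrow> sub p q; quot r e }"

text \<open>Diagonal entries, with the convention that the entry at position $(0,0)$ is 1.\<close>

definition diag_at :: "(nat \<Rightarrow> nat \<Rightarrow> rat) \<Rightarrow> nat \<Rightarrow> rat" where
  "diag_at M k = (if k = 0 then 1 else M k k)"

definition set_entry ::
  "(nat \<Rightarrow> nat \<Rightarrow> rat) \<Rightarrow> nat \<Rightarrow> nat \<Rightarrow> rat \<Rightarrow> (nat \<Rightarrow> nat \<Rightarrow> rat)" where
  "set_entry M i j x = M(i := (M i)(j := x))"

definition step ::
  "nat \<Rightarrow> (nat \<Rightarrow> rat) \<Rightarrow> (nat \<Rightarrow> nat \<Rightarrow> rat) \<Rightarrow> nat \<Rightarrow> (nat \<Rightarrow> rat) comp" where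
  "step n y \<Lambda> k =
     for_loop (k + 1) n
       (\<lambda>i y'. do {
          x \<leftarrow> cross (\<Lambda> k k) (y i) (\<Lambda> i k) (y k) (diag_at \<Lambda> (k - 1));
          ret (y'(i := x)) })
       y"

type_synonym factors = "(nat \<Rightarrow> nat \<Rightarrow> rat) \<times> (nat \<Rightarrow> nat \<Rightarrow> rat)"

text \<open>A diagonal value is computed once and stored in both factors.\<close>

definition set_diag :: "factors \<Rightarrow> nat \<Rightarrow> rat \<Rightarrow> factors" where
  "set_diag = (\<lambda>(l, u) i x. (set_entry l i i x, set_entry u i i x))"

definition initialize ::
  "nat \<Rightarrow> (nat \<Rightarrow> nat \<Rightarrow> rat) \<Rightarrow> (nat \<Rightarrow> nat \<Rightarrow> rat) \<Rightarrow> (nat \<Rightarrow> rat) \<Rightarrow> (nat \<Rightarrow> rat) \<Rightarrow> (nat \<Rightarrow> rat)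
    \<Rightarrow> factors comp" where
  "initialize n L U a v w =
     do {
       x \<leftarrow> add_mul (a 1) (v 1) (w 1);
       for_loop 2 n
         (\<lambda>i (l, u). do {
            p \<leftarrow> add_mul (U 1 i) (v 1) (w i);
            q \<leftarrow> add_mul (L i 1) (v i) (w 1);
            d \<leftarrow> add_mul (a i) (v i) (w i);
            ret (set_diag (set_entry l i 1 q, set_entry u 1 i p) i d) })
         (set_diag (\<lambda>_ _. 0, \<lambda>_ _. 0) 1 x)
     }"

definition update_diag :: "nat \<Rightarrow> nat \<Rightarrow> factors \<Rightarrow> factors comp" where
  "update_diag k i = (\<lambda>(l, u).
     do {
       x \<leftarrow> cross (diag_at l (k - 1)) (l i i) (u (k - 1) i) (l i (k - 1)) (diag_at l (k - 2));
       ret (set_diag (l, u) i x)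
     })"

text \<open>Here \<open>y\<close>, \<open>z\<close> are $y^{(k-1)}$, $z^{(k-1)}$ and \<open>y'\<close>, \<open>z'\<close> are $y^{(k)}$, $z^{(k)}$.\<close>

definition update_offdiag ::
  "nat \<Rightarrow> (nat \<Rightarrow> rat) \<Rightarrow> (nat \<Rightarrow> rat) \<Rightarrow> (nat \<Rightarrow> rat) \<Rightarrow> (nat \<Rightarrow> rat) \<Rightarrow> nat
    \<Rightarrow> factors \<Rightarrow> factors comp" where
  "update_offdiag k y z y' z' i = (\<lambda>(l, u).
     do {
       p \<leftarrow> cross (l k k) (y i) (diag_at l (k - 1)) (y' i) (y k);
       q \<leftarrow> cross (u k k) (z i) (diag_at u (k - 1)) (z' i) (z k);
       ret (set_entry l i k p, set_entry u k i q)
     })"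

definition ref_rou ::
  "nat \<Rightarrow> (nat \<Rightarrow> nat \<Rightarrow> rat) \<Rightarrow> (nat \<Rightarrow> nat \<Rightarrow> rat) \<Rightarrow> (nat \<Rightarrow> rat) \<Rightarrow> (nat \<Rightarrow> rat) \<Rightarrow> (nat \<Rightarrow> rat)
    \<Rightarrow> factors comp" where
  "ref_rou n L U a v w =
     do {
       lu \<leftarrow> initialize n L U a v w;
       y1 \<leftarrow> step n v L 1;
       z1 \<leftarrow> step n w (\<lambda>i j. U j i) 1;
       (lu, y, z) \<leftarrow> for_loop 2 (n - 1)
         (\<lambda>k (lu, y, z). do {
            y' \<leftarrow> step n y L k;
            z' \<leftarrow> step n z (\<lambda>i j. U j i) k;
            lu \<leftarrow> for_loop k n
              (\<lambda>i lu. do {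
                 lu \<leftarrow> update_diag k i lu;
                 if i > k then update_offdiag k y z y' z' i lu else ret lu })
              lu;
            ret (lu, y', z') })
         (lu, y1, z1);
       update_diag n n lu
     }"

end

theory Submission
  imports Defs
begin

text \<open>
  The control flow does not depend on the data, so the cost of a run is bounded by composing the
  bounds of its parts.  Each pass \<open>k\<close> of the main loop does a constant number of operations
  on each of at most \<open>n\<close> indices, because the off-diagonal entries are read off from \<open>y\<close> and
  \<open>z\<close> instead of being eliminated afresh.
\<close>

text \<open>Undefined runs satisfy every bound.\<close>

definition cost_le :: "'a comp \<Rightarrow> nat \<Rightarrow> bool" where
  "cost_le m b \<longleftrightarrow> (\<forall>x c. m = Done x c \<longrightarrow> c \<le> b)"

lemma cost_le_mono: "cost_le m a \<Longrightarrow> a \<le> b \<Longrightarrow> cost_le m b"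
  by (force simp: cost_le_def)

text \<open>Costs add along a bind. The bound on \<open>f x\<close> is uniform in \<open>x\<close>,
  so no intermediate value has to be tracked. If either part is undefined, so is the whole
  run.\<close>

lemma cost_le_bind:
  assumes "cost_le m a" and "\<And>x. cost_le (f x) b"
  shows "cost_le (bind_comp m f) (a + b)"
  using assms by (cases m) (auto simp: cost_le_def add_mono split: comp.splits)

lemma cost_le_ret: "cost_le (ret x) 0"
  by (simp add: cost_le_def ret_def)

lemma cost_le_arith:
  "cost_le (add x y) 1" "cost_le (sub x y) 1" "cost_le (mul x y) 1" "cost_le (quot x y) 1"
  by (auto simp: cost_le_def add_def sub_def mul_def quot_def)

lemma cost_le_for_list:
  assumes "\<And>i s. cost_le (f i s) b"
  shows "cost_le (for_list is f s) (length is * b)"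
proof (induction "is" arbitrary: s)
  case Nil
  show ?case by (simp add: cost_le_ret)
next
  case (Cons i "is")
  have "cost_le (bind_comp (f i s) (for_list is f)) (b + length is * b)"
    by (intro cost_le_bind assms Cons.IH)
  then show ?case by simp
qed

text \<open>\<open>Suc n - m\<close> is the length of the inclusive range and truncates to 0 when
  \<open>m > n\<close>. The bound \<open>b\<close> depends on neither index nor state.\<close>

lemma cost_le_for_loop:
  assumes "\<And>i s. cost_le (f i s) b"
  shows "cost_le (for_loop m n f s) ((Suc n - m) * b)"
  using cost_le_for_list[of f b "[m..<Suc n]" s, OF assms]
  unfolding for_loop_def by (simp del: upt_Suc)

lemma cost_le_add_mul: "cost_le (add_mul a x y) 2"
proof -
  \<comment> \<open>The unevaluated sum mirrors the nesting of binds, so that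
    \<open>cost_le_bind\<close> splits it by unification; later bounds are written the same
    way.\<close>
  have "cost_le (add_mul a x y) (1 + 1)"
    unfolding add_mul_def by (intro cost_le_bind cost_le_arith)
  then show ?thesis by (simp add: numeral_eq_Suc)
qed

lemma cost_le_cross: "cost_le (cross a b c d e) 4"
proof -
  have "cost_le (cross a b c d e) (1 + (1 + (1 + 1)))"
    unfolding cross_def by (intro cost_le_bind cost_le_arith)
  then show ?thesis by (simp add: numeral_eq_Suc)
qed

lemma cost_le_step: "cost_le (step n y \<Lambda> k) ((n - k) * 4)"
proof -
  have "cost_le (step n y \<Lambda> k) ((Suc n - (k + 1)) * (4 + 0))"
    unfolding step_def by (intro cost_le_for_loop cost_le_bind cost_le_cross cost_le_ret)
  then show ?thesis by simp
qed

lemma cost_le_initialize: "cost_le (initialize n L U a v w) (2 + (n - 1) * 6)"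
proof -
  have "cost_le (initialize n L U a v w) (2 + (Suc n - 2) * (2 + (2 + (2 + 0))))"
    \<comment> \<open>\<open>split_def\<close> turns pair patterns into projections, which exposes
      the binds in the loop body.\<close>
    unfolding initialize_def split_def
    by (intro cost_le_bind cost_le_for_loop cost_le_add_mul cost_le_ret)
  then show ?thesis by simp
qed

lemma cost_le_update_diag: "cost_le (update_diag k i lu) 4"
proof -
  have "cost_le (update_diag k i lu) (4 + 0)"
    unfolding update_diag_def split_def by (intro cost_le_bind cost_le_cross cost_le_ret)
  then show ?thesis by simp
qed

lemma cost_le_update_offdiag: "cost_le (update_offdiag k y z y' z' i lu) 8"
proof -
  have "cost_le (update_offdiag k y z y' z' i lu) (4 + (4 + 0))"
    unfolding update_offdiag_def split_def by (intro cost_le_bind cost_le_cross cost_le_ret)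
  then show ?thesis by simp
qed

text \<open>At \<open>n = 0\<close> the first entry and the last diagonal update still cost 6
  operations; from \<open>n = 1\<close> on the square absorbs such constants.\<close>

lemma cost_le_ref_rou:
  assumes "n \<ge> 1"
  shows "cost_le (ref_rou n L U a v w) (38 * n\<^sup>2)"
proof -
  have step: "cost_le (step n y \<Lambda> k) (n * 4)" for y \<Lambda> k
    by (rule cost_le_mono[OF cost_le_step]) simp
  have update: "cost_le (if i > k then update_offdiag k y z y' z' i lu else ret lu) 8"
    for k y z y' z' i lu
    using cost_le_update_offdiag cost_le_mono[OF cost_le_ret] by auto
  have row: "cost_le
      (for_loop k n (\<lambda>i lu. bind_comp (update_diag k i lu)
        (\<lambda>lu. if i > k then update_offdiag k y z y' z' i lu else ret lu)) lu)
      ((Suc n - k) * (4 + 8))" for k y z y' z' lu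
    by (intro cost_le_for_loop cost_le_bind cost_le_update_diag update)
  \<comment> \<open>The left side is 14 at \<open>n = 1\<close> and
    \<open>20 * n^2 - 14 * n - 24\<close> for \<open>n \<ge> 2\<close>; 38 is a generous
    constant.\<close>
  have "(2 + (n - 1) * 6) + (n * 4 + (n * 4 + ((Suc (n - 1) - 2) *
      (n * 4 + (n * 4 + (Suc n * 12 + 0))) + 4))) \<le> 38 * n\<^sup>2"
    using assms by (cases n) (auto simp: power2_eq_square algebra_simps)
  \<comment> \<open>The inner ranges shrink with \<open>k\<close>, but
    \<open>cost_le_for_loop\<close> wants one bound for all passes. Relaxing
    \<open>Suc n - k\<close> to \<open>Suc n\<close> costs only a constant factor.\<close>
  moreover have "cost_le (ref_rou n L U a v w)
     ((2 + (n - 1) * 6) + (n * 4 + (n * 4 + ((Suc (n - 1) - 2) *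
      (n * 4 + (n * 4 + (Suc n * 12 + 0))) + 4))))"
    unfolding ref_rou_def split_def
    by (intro cost_le_bind cost_le_initialize step cost_le_for_loop cost_le_update_diag
        cost_le_ret cost_le_mono[OF row]) simp
  ultimately show ?thesis
    by (rule cost_le_mono[rotated])
qed

theorem theorem8:
  shows "\<exists>T :: nat \<Rightarrow> real. T \<in> O(\<lambda>n. real n ^ 2) \<and>
    (\<forall>n \<ge> 2. \<forall>A \<in> carrier_mat n n. \<forall>v \<in> carrier_vec n. \<forall>w \<in> carrier_vec n.
       leading_minors_nonzero A \<longrightarrow>
       leading_minors_nonzero (rank_one_update A v w) \<longrightarrow>
       (\<forall>l u ops.
          ref_rou n (ref_L A) (ref_U A) (\<lambda>i. mat_at A i i) (vec_at v) (vec_at w)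
            = Done (l, u) ops
          \<longrightarrow> real ops \<le> T n))"
proof (intro exI conjI allI ballI impI)
  \<comment> \<open>This fixes \<open>T\<close>; it depends on \<open>n\<close> alone, so one
    function serves all inputs.\<close>
  show "(\<lambda>n. 38 * real n ^ 2) \<in> O(\<lambda>n. real n ^ 2)"
    by simp
next
  fix n :: nat and A :: "int mat" and v w :: "int vec" and l u ops
  assume "2 \<le> n"
    and "ref_rou n (ref_L A) (ref_U A) (\<lambda>i. mat_at A i i) (vec_at v) (vec_at w) = Done (l, u) ops"
  with cost_le_ref_rou[of n] have "ops \<le> 38 * n\<^sup>2"
    unfolding cost_le_def by (metis one_le_numeral order_trans)
  then have "real ops \<le> real (38 * n\<^sup>2)"
    by (rule of_nat_mono)
  then show "real ops \<le> 38 * real n ^ 2"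
    by simp
qed

end
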